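(* Let $\theta\in[0,1)$ and $\omega=\mathcal{A}(\theta)$. Then (1) $\omega$ is rational if and only if $\theta=m/2^n$ for some integers $n\ge0$, $0\le m\le 2^n-1$; (2) $\omega$ is a quadratic irrational number if and only if $\theta$ is a rational number not of the form $m/2^n$ (equivalently, the binary expansion of $\theta$ is eventually periodic but not finite).
   Context: Stern's diatomic integers: for integers $n\ge0$, $0\le m\le2^n$, $[2^0:0]=0$, $[2^0:1]=1$, $[2^{n+1}:2m]=[2^n:m]$, $[2^{n+1}:2m+1]=[2^n:m]+[2^n:m+1]$. Assembly function: the map $m/2^n\mapsto[2^n:m]/[2^n:2^n-m]$ ($0\le m\le 2^n-1$) on dyadic rationals in $[0,1)$ extends uniquely to a continuous strictly increasing bijection $\mathcal{A}:[0,1)\to[0,\infty)$. A quadratic irrational number is an irrational real root of a quadratic polynomial with integer coefficients. *)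

theory Defs
  imports Complex_Main "HOL-Library.FuncSet"
begin

(* stern n m is [2^n : m]; it is meaningful only for m \<le> 2^n. *)
fun stern :: "nat \<Rightarrow> nat \<Rightarrow> nat" where
  "stern 0 m = (if m = 0 then 0 else 1)"
| "stern (Suc n) m =
     (if even m then stern n (m div 2) else stern n (m div 2) + stern n (m div 2 + 1))"

lemma stern_0_0: "stern 0 0 = 0"
  and stern_0_1: "stern 0 1 = 1"
  and stern_double: "stern (Suc n) (2 * m) = stern n m"
  and stern_double_plus1: "stern (Suc n) (2 * m + 1) = stern n m + stern n (m + 1)"
  by simp_all

definition is_assembly :: "(real \<Rightarrow> real) \<Rightarrow> bool" where
  "is_assembly f \<longleftrightarrow>
     (\<forall>n m. m \<le> 2 ^ n - 1 \<longrightarrow>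
        f (real m / 2 ^ n) = real (stern n m) / real (stern n (2 ^ n - m))) \<and>
     continuous_on {0..<1} f \<and>
     strict_mono_on {0..<1} f \<and>
     bij_betw f {0..<1} {0..}"

(* Membership in extensional fixes the values outside [0,1), where the conditions
   in is_assembly say nothing; without it the description would not be unique. *)
definition assembly :: "real \<Rightarrow> real" where
  "assembly = (THE f. f \<in> extensional {0..<1} \<and> is_assembly f)"

definition quadratic_irrational :: "real \<Rightarrow> bool" where
  "quadratic_irrational x \<longleftrightarrow>
     x \<notin> \<rat> \<and>
     (\<exists>a b c :: int. a \<noteq> 0 \<and> of_int a * x\<^sup>2 + of_int b * x + of_int c = 0)"

definition unit_dyadic :: "real \<Rightarrow> bool" where
  "unit_dyadic x \<longleftrightarrow> (\<exists>n m :: nat. m \<le> 2 ^ n - 1 \<and> x = real m / 2 ^ n)"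

(* Coefficient of 2^-(k+1) in the standard binary expansion of x in [0,1), that is,
   the expansion that is not eventually constantly 1. *)
definition binary_digit :: "real \<Rightarrow> nat \<Rightarrow> int" where
  "binary_digit x k = \<lfloor>2 ^ Suc k * x\<rfloor> mod 2"

definition eventually_periodic :: "(nat \<Rightarrow> 'a) \<Rightarrow> bool" where
  "eventually_periodic d \<longleftrightarrow> (\<exists>N p. p > 0 \<and> (\<forall>k\<ge>N. d (k + p) = d k))"

definition finite_expansion :: "(nat \<Rightarrow> int) \<Rightarrow> bool" where
  "finite_expansion d \<longleftrightarrow> (\<exists>N. \<forall>k\<ge>N. d k = 0)"

end

theory Submission imports Defs "HOL-Library.Quadratic_Discriminant" begin

text \<open>Neighbouring quotients [2^n : m] / [2^n : 2^n - m] are Farey neighbours, so they increase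
  strictly with m / 2^n, and every nonnegative rational is one of them. The assembly function A is
  therefore the unique increasing extension, it takes rational values exactly at the dyadic angles,
  and it satisfies A (x / 2) = A x / (1 + A x) and A ((1 + x) / 2) = 1 + A x. Thus doubling the angle
  acts on values by integral Moebius maps of determinant 1. If the angle is rational, its doubling
  orbit repeats, so some value is fixed by a nontrivial such map and is quadratic. Conversely, these
  maps preserve the discriminant of a quadratic equation satisfied by the value. Along the orbit
  the conjugate root eventually becomes and stays negative, which leaves finitely many
  equations, so the orbit repeats and the angle is rational.\<close>

lemma le_2_power_minus_1_iff: "m \<le> 2 ^ n - 1 \<longleftrightarrow> m < 2 ^ n" for n m :: nat
proof -
  have "(2::nat) ^ n > 0" by simp
  then show ?thesis by linarith
qed

section \<open>Stern's diatomic quotients\<close>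

lemma stern_0_right [simp]: "stern n 0 = 0"
  by (induction n) auto

lemma stern_pos: "m > 0 \<Longrightarrow> stern n m > 0"
proof (induction n arbitrary: m)
  case (Suc n)
  show ?case
  proof (cases "even m")
    case True
    then have "m div 2 > 0" using Suc.prems by auto
    then show ?thesis using True Suc.IH by simp
  next
    case False
    then show ?thesis using Suc.IH[of "m div 2 + 1"] by simp
  qed
qed simp

text \<open>Rows of consecutive levels start with the same segment of Stern's diatomic sequence: the
  recursion takes the same parity branch at both levels.\<close>

lemma stern_Suc_le: "m \<le> 2 ^ n \<Longrightarrow> stern (Suc n) m = stern n m"
proof (induction n arbitrary: m)
  case 0
  then have "m = 0 \<or> m = 1" by auto
  then show ?case by auto
next
  case (Suc n)
  show ?case
  proof (cases "even m")
    case True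
    have "m div 2 \<le> 2 ^ n" using Suc.prems by auto
    from Suc.IH[OF this] show ?thesis using True
      by (simp only: stern.simps(2)[of "Suc n"] stern.simps(2)[of n m] if_True)
  next
    case False
    \<comment> \<open>Oddness excludes the endpoint, which keeps the right neighbour
      \<open>m div 2 + 1\<close> within reach of the induction hypothesis.\<close>
    then have "m \<noteq> 2 ^ Suc n" by auto
    then have le: "m div 2 \<le> 2 ^ n" "m div 2 + 1 \<le> 2 ^ n" using Suc.prems by auto
    show ?thesis using False Suc.IH[OF le(1)] Suc.IH[OF le(2)]
      by (simp only: stern.simps(2)[of "Suc n"] stern.simps(2)[of n m] if_False)
  qed
qed

text \<open>Reflection in the row preserves parity at positive levels, so both sides obey the same
  recursion. This yields the numerators on the upper half of a row and, for mirrored indices, the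
  denominators on the lower half.\<close>

lemma stern_Suc_upper_half:
  "m \<le> 2 ^ n \<Longrightarrow> stern (Suc n) (2 ^ n + m) = stern n m + stern n (2 ^ n - m)"
proof (induction n arbitrary: m)
  case 0
  then have "m = 0 \<or> m = 1" by auto
  then show ?case by auto
next
  case (Suc n)
  show ?case
  proof (cases "even m")
    case True
    then obtain k where k: "m = 2 * k" by (elim evenE)
    have le: "k \<le> 2 ^ n" using Suc.prems k by auto
    have e: "2 ^ Suc n + m = 2 * (2 ^ n + k)" "2 ^ Suc n - m = 2 * (2 ^ n - k)"
      using k by auto
    show ?thesis unfolding e unfolding k stern_double using Suc.IH[OF le] .
  next
    case False
    then obtain k where k: "m = 2 * k + 1" by (elim oddE)
    have le: "k \<le> 2 ^ n" "k + 1 \<le> 2 ^ n" using Suc.prems k by auto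
    have e: "2 ^ Suc n + m = 2 * (2 ^ n + k) + 1" "2 ^ Suc n - m = 2 * (2 ^ n - (k + 1)) + 1"
      using k le by auto
    have e2: "2 ^ n - (k + 1) + 1 = 2 ^ n - k" using le by simp
    show ?thesis unfolding e unfolding k stern_double_plus1 e2
      using Suc.IH[OF le(1)] Suc.IH[OF le(2)] by simp
  qed
qed

text \<open>The Farey neighbour relation. Odd positions of the next row are mediants of their
  neighbours; inserting a mediant adds one column of a 2 by 2 matrix to the other and keeps the
  determinant 1. The form with \<open>+ 1\<close> avoids subtraction of naturals.\<close>

lemma stern_det:
  "m < 2 ^ n \<Longrightarrow>
    stern n (m + 1) * stern n (2 ^ n - m) = stern n m * stern n (2 ^ n - (m + 1)) + 1"
proof (induction n arbitrary: m)
  case (Suc n)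
  show ?case
  proof (cases "even m")
    case True
    then obtain k where k: "m = 2 * k" by (elim evenE)
    have lt: "k < 2 ^ n" using Suc.prems k by auto
    have e: "2 ^ Suc n - m = 2 * (2 ^ n - k)"
      "2 ^ Suc n - (m + 1) = 2 * (2 ^ n - (k + 1)) + 1" "m + 1 = 2 * k + 1"
      using k lt by auto
    have e2: "2 ^ n - (k + 1) + 1 = 2 ^ n - k" using lt by simp
    show ?thesis unfolding e(1,2) unfolding e(3) unfolding k stern_double stern_double_plus1 e2
      using Suc.IH[OF lt] by (simp add: algebra_simps)
  next
    case False
    then obtain k where k: "m = 2 * k + 1" by (elim oddE)
    have lt: "k < 2 ^ n" using Suc.prems k by auto
    have e: "2 ^ Suc n - m = 2 * (2 ^ n - (k + 1)) + 1"
      "2 ^ Suc n - (m + 1) = 2 * (2 ^ n - (k + 1))" "m + 1 = 2 * (k + 1)"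
      using k lt by auto
    have e2: "2 ^ n - (k + 1) + 1 = 2 ^ n - k" using lt by simp
    show ?thesis unfolding e(1,2) unfolding e(3) unfolding k stern_double stern_double_plus1 e2
      using Suc.IH[OF lt] by (simp add: algebra_simps)
  qed
qed simp

definition stern_quot :: "nat \<Rightarrow> nat \<Rightarrow> real" where
  "stern_quot n m = real (stern n m) / real (stern n (2 ^ n - m))"

lemma stern_quot_nonneg: "stern_quot n m \<ge> 0"
  by (simp add: stern_quot_def)

lemma stern_quot_Suc_less:
  assumes "m + 1 < 2 ^ n"
  shows "stern_quot n m < stern_quot n (m + 1)"
proof -
  have pos: "stern n (2 ^ n - m) > 0" "stern n (2 ^ n - (m + 1)) > 0"
    using assms by (auto intro!: stern_pos)
  have "stern n m * stern n (2 ^ n - (m + 1)) < stern n (m + 1) * stern n (2 ^ n - m)"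
    using stern_det[of m n] assms by linarith
  then have "real (stern n m) * real (stern n (2 ^ n - (m + 1)))
      < real (stern n (m + 1)) * real (stern n (2 ^ n - m))"
    by (simp only: of_nat_mult[symmetric] of_nat_less_iff)
  then show ?thesis unfolding stern_quot_def using pos
    by (simp add: divide_less_eq less_divide_eq mult.commute)
qed

lemma stern_quot_strict_mono_level:
  assumes "m < m'" "m' < 2 ^ n"
  shows "stern_quot n m < stern_quot n m'"
  using assms
proof (induction m')
  case (Suc k)
  then show ?case using stern_quot_Suc_less[of k n]
    by (cases "m = k") auto
qed simp

text \<open>Makes the quotient depend only on the dyadic number, not on its representation, so that
  two dyadics can be compared at a common level.\<close>

lemma stern_quot_refine: "stern_quot (k + n) (2 ^ k * m) = stern_quot n m"
proof (induction k)
  case (Suc k)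
  have e: "2 ^ Suc k * m = 2 * (2 ^ k * m)"
    "2 ^ (Suc k + n) - 2 ^ Suc k * m = 2 * (2 ^ (k + n) - 2 ^ k * m)"
    by (auto simp: algebra_simps)
  show ?case using Suc.IH unfolding stern_quot_def e(2) unfolding e(1) add_Suc stern_double .
qed simp

lemma stern_quot_less:
  assumes "real m / 2 ^ n < real m' / 2 ^ n'" "m' < 2 ^ n'"
  shows "stern_quot n m < stern_quot n' m'"
proof -
  have "real (2 ^ n' * m) < real (2 ^ n * m')"
    using assms(1) by (simp add: field_simps)
  then have "2 ^ n' * m < 2 ^ n * m'" by (simp only: of_nat_less_iff)
  moreover have "2 ^ n * m' < 2 ^ (n + n')" using assms(2) by (simp add: power_add)
  ultimately have "stern_quot (n + n') (2 ^ n' * m) < stern_quot (n + n') (2 ^ n * m')"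
    by (rule stern_quot_strict_mono_level)
  then show ?thesis
    using stern_quot_refine[of n' n m] stern_quot_refine[of n n' m'] by (simp add: add.commute)
qed

section \<open>Quotients on the two halves of a row, and the Euclidean algorithm\<close>

lemma stern_quot_lower_half:
  assumes "m < 2 ^ n"
  shows "stern_quot (Suc n) m = stern_quot n m / (1 + stern_quot n m)"
proof -
  \<comment> \<open>The index of the denominator lies in the upper half with mirrored offset, so the
    old numerator is added to the old denominator.\<close>
  have e: "2 ^ Suc n - m = 2 ^ n + (2 ^ n - m)" using assms by simp
  have pos: "stern n (2 ^ n - m) > 0" using assms by (auto intro!: stern_pos)
  have "stern (Suc n) (2 ^ Suc n - m) = stern n (2 ^ n - m) + stern n m"
    unfolding e using stern_Suc_upper_half[of "2 ^ n - m" n] assms by simp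
  moreover have "stern (Suc n) m = stern n m" using stern_Suc_le assms by simp
  ultimately show ?thesis unfolding stern_quot_def using pos by (simp add: field_simps)
qed

lemma stern_quot_upper_half:
  assumes "m < 2 ^ n"
  shows "stern_quot (Suc n) (2 ^ n + m) = 1 + stern_quot n m"
proof -
  have e: "2 ^ Suc n - (2 ^ n + m) = 2 ^ n - m" using assms by simp
  have pos: "stern n (2 ^ n - m) > 0" using assms by (auto intro!: stern_pos)
  have "stern (Suc n) (2 ^ n - m) = stern n (2 ^ n - m)"
    by (rule stern_Suc_le) simp
  moreover have "stern (Suc n) (2 ^ n + m) = stern n m + stern n (2 ^ n - m)"
    using stern_Suc_upper_half assms by simp
  ultimately show ?thesis unfolding stern_quot_def e using pos by (simp add: field_simps)
qed

text \<open>The subtractive Euclidean algorithm: \<open>p < q\<close> undoes the lower-half map,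
  \<open>p \<ge> q\<close> undoes the upper-half map, and \<open>p + q\<close> decreases until
  \<open>p = 0\<close>.\<close>

lemma stern_quot_surj_rat:
  fixes p q :: nat
  assumes "q > 0"
  shows "\<exists>n m. m < 2 ^ n \<and> stern_quot n m = real p / real q"
  using assms
proof (induction "p + q" arbitrary: p q rule: less_induct)
  case less
  consider "p = 0" | "p > 0" "p < q" | "p \<ge> q" by linarith
  then show ?case
  proof cases
    case 1
    then have "(0::nat) < 2 ^ 0 \<and> stern_quot 0 0 = real p / real q"
      by (simp add: stern_quot_def)
    then show ?thesis by blast
  next
    case 2
    from less.hyps[of p "q - p"] 2 obtain n m where
      nm: "m < 2 ^ n" "stern_quot n m = real p / real (q - p)" by auto
    have "stern_quot (Suc n) m = real p / real q"
      unfolding stern_quot_lower_half[OF nm(1)] nm(2) using 2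
      by (simp add: of_nat_diff divide_simps)
    moreover have "m < 2 ^ Suc n" using nm(1) by simp
    ultimately show ?thesis by blast
  next
    case 3
    from less.hyps[of "p - q" q] 3 less.prems obtain n m where
      nm: "m < 2 ^ n" "stern_quot n m = real (p - q) / real q" by auto
    have "stern_quot (Suc n) (2 ^ n + m) = real p / real q"
      unfolding stern_quot_upper_half[OF nm(1)] nm(2) using 3 less.prems
      by (simp add: of_nat_diff divide_simps)
    moreover have "2 ^ n + m < 2 ^ Suc n" using nm(1) by simp
    ultimately show ?thesis by blast
  qed
qed

lemma stern_quot_surj_Rats:
  assumes "r \<in> \<rat>" "r \<ge> 0"
  obtains n m where "m < 2 ^ n" "stern_quot n m = r"
proof -
  obtain p q :: nat where "q \<noteq> 0" "\<bar>r\<bar> = real p / real q"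
    using Rats_abs_nat_div_natE[OF assms(1)] by metis
  then show ?thesis using stern_quot_surj_rat[of q p] assms(2) that by auto
qed

section \<open>Existence, uniqueness and functional equations of the assembly function\<close>

text \<open>A form of \<open>is_assembly\<close> that is easy to check for transformed functions;
  continuity and bijectivity are recovered from it in
  \<open>is_assembly_iff_interpolates\<close>.\<close>

definition interpolates :: "(real \<Rightarrow> real) \<Rightarrow> bool" where
  "interpolates f \<longleftrightarrow> strict_mono_on {0..<1} f \<and>
     (\<forall>n m. m < 2 ^ n \<longrightarrow> f (real m / 2 ^ n) = stern_quot n m)"

lemma dyadic_in_unit: "m < 2 ^ n \<Longrightarrow> real m / 2 ^ n \<in> {0..<1}"
  by (simp add: field_simps flip: of_nat_power)

text \<open>Rationals are dense and each nonnegative one is attained at a dyadic point. All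
  interpolating functions agree there, which is the last conclusion.\<close>

lemma interpolates_value_between:
  assumes "interpolates f" "0 \<le> a" "a < b"
  obtains e where "e \<in> {0..<1}" "a < f e" "f e < b"
    "\<And>g. interpolates g \<Longrightarrow> g e = f e"
proof -
  obtain r where r: "r \<in> \<rat>" "a < r" "r < b" using Rats_dense_in_real[OF assms(3)] by blast
  then obtain n m where nm: "m < 2 ^ n" "stern_quot n m = r"
    using stern_quot_surj_Rats assms(2) by (metis less_eq_real_def order_trans)
  show ?thesis
    by (rule that[of "real m / 2 ^ n"])
      (use nm r assms(1) dyadic_in_unit in \<open>auto simp: interpolates_def\<close>)
qed

lemma interpolates_0:
  assumes "interpolates f"
  shows "f 0 = 0"
proof -
  have "f (real 0 / 2 ^ 0) = stern_quot 0 0"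
    using assms unfolding interpolates_def by (metis less_numeral_extra(1) power_0)
  then show ?thesis by (simp add: stern_quot_def)
qed

lemma interpolates_nonneg:
  assumes "interpolates f" "x \<in> {0..<1}"
  shows "f x \<ge> 0"
proof (cases "x = 0")
  case False
  then have "f 0 < f x"
    using assms by (intro strict_mono_onD[of "{0..<1}" f]) (auto simp: interpolates_def)
  then show ?thesis using interpolates_0[OF assms(1)] by simp
qed (simp add: interpolates_0[OF assms(1)])

lemma interpolates_less_iff:
  assumes "interpolates f" "x \<in> {0..<1}" "y \<in> {0..<1}"
  shows "f x < f y \<longleftrightarrow> x < y"
  using assms strict_mono_onD[of "{0..<1}" f] unfolding interpolates_def
  by (metis linorder_less_linear order_less_asym)

lemma interpolates_eq_iff:
  assumes "interpolates f" "x \<in> {0..<1}" "y \<in> {0..<1}"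
  shows "f x = f y \<longleftrightarrow> x = y"
  using interpolates_less_iff[OF assms] interpolates_less_iff[OF assms(1,3,2)]
  by (metis linorder_less_linear order_less_irrefl)

text \<open>If \<open>f x\<close> exceeded \<open>g x\<close>, a dyadic point with common value
  strictly between them would lie on both sides of \<open>x\<close>.\<close>

lemma interpolates_le:
  assumes "interpolates f" "interpolates g" "x \<in> {0..<1}"
  shows "f x \<le> g x"
proof (rule ccontr)
  assume "\<not> f x \<le> g x"
  then obtain e where e: "e \<in> {0..<1}" "g x < g e" "g e < f x" "f e = g e"
    using interpolates_value_between[OF assms(2) interpolates_nonneg[OF assms(2,3)], of "f x"] assms(1)
    by (metis not_le)
  then have "x < e" "e < x"
    using interpolates_less_iff assms by (metis, metis)
  then show False by simp
qed

lemma interpolates_unique: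
  assumes "interpolates f" "interpolates g" "x \<in> {0..<1}"
  shows "f x = g x"
  using interpolates_le assms by (intro antisym) auto

lemma interpolates_surj:
  assumes f: "interpolates f" and w: "w \<ge> 0"
  obtains x where "x \<in> {0..<1}" "f x = w"
proof -
  \<comment> \<open>The preimage is the supremum of \<open>S\<close>: if its value differed from
    \<open>w\<close>, a dyadic value strictly between the two would contradict the choice of
    supremum.\<close>
  define S where "S = {x \<in> {0..<1}. f x \<le> w}"
  have S0: "0 \<in> S" using interpolates_0[OF f] w by (simp add: S_def)
  \<comment> \<open>A value above \<open>w\<close> keeps the supremum strictly below 1.\<close>
  obtain u where u: "u \<in> {0..<1}" "w < f u"
    using interpolates_value_between[OF f w, of "w + 1"] by (metis less_add_one)
  have ub: "x \<le> u" if "x \<in> S" for x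
    using that u interpolates_less_iff[OF f u(1), of x] by (force simp: S_def)
  have bdd: "bdd_above S" using ub by (rule bdd_aboveI)
  define t where "t = Sup S"
  have t0: "t \<ge> 0" unfolding t_def by (rule cSup_upper[OF S0 bdd])
  have "t \<le> u" unfolding t_def using S0 ub by (intro cSup_least) auto
  then have t: "t \<in> {0..<1}" using t0 u by simp
  have "\<not> f t < w"
  proof
    assume "f t < w"
    then obtain e where e: "e \<in> {0..<1}" "f t < f e" "f e < w"
      using interpolates_value_between[OF f interpolates_nonneg[OF f t]] by metis
    then have "e \<le> t" unfolding t_def using bdd by (intro cSup_upper) (auto simp: S_def)
    then show False using e interpolates_less_iff[OF f t e(1)] by simp
  qed
  moreover have "\<not> w < f t"
  proof
    assume "w < f t"
    then obtain e where e: "e \<in> {0..<1}" "w < f e" "f e < f t"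
      using interpolates_value_between[OF f w] by metis
    then have "e < Sup S" using interpolates_less_iff[OF f e(1) t] by (simp add: t_def)
    then obtain d where d: "d \<in> S" "e < d" using less_cSup_iff[OF _ bdd] S0 by blast
    then have "f e < f d" using interpolates_less_iff[OF f e(1), of d] by (simp add: S_def)
    then show False using d e by (simp add: S_def)
  qed
  ultimately show ?thesis using that[OF t] by linarith
qed

lemma interpolates_continuous:
  assumes f: "interpolates f"
  shows "continuous_on {0..<1} f"
proof -
  \<comment> \<open>The continuity criterion for monotone functions wants an open image, and
    \<open>[0, \<infinity>)\<close> is not open. Extending by the identity to negative arguments
    makes the image all of the reals.\<close>
  define g where "g x = (if x < 0 then x else f x)" for x
  have im: "g ` {..<1} = UNIV"
  proof -
    have "y \<in> g ` {..<1}" for y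
    proof (cases "y < 0")
      case True
      then show ?thesis by (intro image_eqI[of _ _ y]) (auto simp: g_def)
    next
      case False
      then have "0 \<le> y" by simp
      then obtain x where "x \<in> {0..<1}" "f x = y" using interpolates_surj[OF f] by blast
      then show ?thesis by (intro image_eqI[of _ _ x]) (auto simp: g_def)
    qed
    then show ?thesis by blast
  qed
  have "g x \<le> g y" if "x \<in> {..<1}" "y \<in> {..<1}" "x \<le> y" for x y
  proof -
    consider "y < 0" | "x < 0" "0 \<le> y" | "0 \<le> x" using that by linarith
    then show ?thesis
    proof cases
      case 2
      then show ?thesis using interpolates_nonneg[OF f, of y] that by (simp add: g_def)
    next
      case 3
      then show ?thesis using interpolates_less_iff[OF f, of y x] that by (force simp: g_def)
    qed (use that in \<open>auto simp: g_def\<close>)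
  qed
  then have "continuous_on {..<1} g"
    by (intro continuous_onI_mono) (auto simp: im)
  then have "continuous_on {0..<1} g" by (rule continuous_on_subset) auto
  then show ?thesis using continuous_on_cong[of "{0..<1}" "{0..<1}" f g] by (simp add: g_def)
qed

lemma is_assembly_iff_interpolates: "is_assembly f \<longleftrightarrow> interpolates f"
proof
  assume "is_assembly f"
  then show "interpolates f"
    unfolding is_assembly_def interpolates_def stern_quot_def le_2_power_minus_1_iff by blast
next
  assume f: "interpolates f"
  have "bij_betw f {0..<1} {0..}"
    unfolding bij_betw_def
  proof
    show "inj_on f {0..<1}" using interpolates_eq_iff[OF f] by (auto simp: inj_on_def)
    show "f ` {0..<1} = {0..}"
      using interpolates_nonneg[OF f] interpolates_surj[OF f] by (auto, metis image_eqI)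
  qed
  then show "is_assembly f" using f interpolates_continuous[OF f]
    unfolding is_assembly_def interpolates_def stern_quot_def le_2_power_minus_1_iff by blast
qed

section \<open>Construction of the assembly function\<close>

lemma interpolates_exists: "\<exists>f. interpolates f"
proof -
  define V where "V x = {stern_quot n m |n m. m < 2 ^ n \<and> real m / 2 ^ n \<le> x}" for x :: real
  \<comment> \<open>The increasing extension from the left: the supremum of the quotients at dyadics
    up to \<open>x\<close>.\<close>
  define f where "f x = Sup (V x)" for x
  have dense: "\<exists>n m. m < 2 ^ n \<and> x < real m / 2 ^ n \<and> real m / 2 ^ n < y"
    if "0 \<le> x" "x < y" "y \<le> 1" for x y :: real
  proof -
    \<comment> \<open>With \<open>2 ^ n * (y - x) > 1\<close>, the first integer above
      \<open>2 ^ n * x\<close> is still below \<open>2 ^ n * y\<close>.\<close>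
    obtain n where n: "1 / (y - x) < 2 ^ n" using real_arch_pow[of 2 "1 / (y - x)"] by auto
    define m where "m = nat (\<lfloor>2 ^ n * x\<rfloor> + 1)"
    have m: "real m = of_int \<lfloor>2 ^ n * x\<rfloor> + 1" using that(1) by (simp add: m_def)
    have lo: "2 ^ n * x < real m" using m by linarith
    have "real m \<le> 2 ^ n * x + 1" using m by linarith
    also have "\<dots> < 2 ^ n * y" using n that(2) by (simp add: field_simps)
    finally have hi: "real m < 2 ^ n * y" .
    also have "\<dots> \<le> 2 ^ n" using that by simp
    finally have "real m < real (2 ^ n)" by simp
    then have "m < 2 ^ n" by (simp only: of_nat_less_iff)
    then show ?thesis using lo hi by (intro exI[of _ n] exI[of _ m]) (simp add: field_simps)
  qed
  have upper: "v < stern_quot n m"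
    if v: "v \<in> V x" and xm: "x < real m / 2 ^ n" "m < 2 ^ n" for v x n m
  proof -
    obtain n' m' where "v = stern_quot n' m'" "real m' / 2 ^ n' \<le> x"
      using v unfolding V_def by blast
    then show ?thesis using stern_quot_less[of m' n' m n] xm by simp
  qed
  have bdd: "bdd_above (V x)" if x: "x \<in> {0..<1}" for x
  proof -
    obtain n m where "m < 2 ^ n" "x < real m / 2 ^ n"
      using dense[of x 1] x by (metis atLeastLessThan_iff order_refl)
    then show ?thesis using upper[of _ x m n] by (intro bdd_aboveI[of _ "stern_quot n m"]) (auto intro: less_imp_le)
  qed
  have ne: "V x \<noteq> {}" if "x \<in> {0..<1}" for x
  proof -
    have "(0::nat) < 2 ^ 0 \<and> real 0 / 2 ^ 0 \<le> x" using that by simp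
    then show ?thesis unfolding V_def by blast
  qed
  have dy: "f (real m / 2 ^ n) = stern_quot n m" if "m < 2 ^ n" for n m
    unfolding f_def
  proof (rule cSup_eq_maximum)
    show "stern_quot n m \<in> V (real m / 2 ^ n)" using that by (auto simp: V_def)
    fix v assume "v \<in> V (real m / 2 ^ n)"
    then obtain n' m' where v: "v = stern_quot n' m'" "real m' / 2 ^ n' \<le> real m / 2 ^ n" "m' < 2 ^ n'"
      by (auto simp: V_def)
    show "v \<le> stern_quot n m"
    proof (rule ccontr)
      assume "\<not> v \<le> stern_quot n m"
      \<comment> \<open>\<open>stern_quot_less\<close> covers distinct dyadics only; two
        representations of one dyadic are refined to a common level.\<close>
      moreover have "real m' / 2 ^ n' = real m / 2 ^ n \<Longrightarrow> v = stern_quot n m"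
      proof -
        assume "real m' / 2 ^ n' = real m / 2 ^ n"
        then have "real (2 ^ n * m') = real (2 ^ n' * m)" by (simp add: field_simps)
        then have "2 ^ n * m' = 2 ^ n' * m" by (simp only: of_nat_eq_iff)
        then show ?thesis
          using stern_quot_refine[of n n' m'] stern_quot_refine[of n' n m] v by (simp add: add.commute)
      qed
      ultimately show False using stern_quot_less[of m' n' m n] v that by fastforce
    qed
  qed
  have "f x < f y" if xy: "x \<in> {0..<1}" "y \<in> {0..<1}" "x < y" for x y
  proof -
    \<comment> \<open>Two dyadics are placed between \<open>x\<close> and \<open>y\<close>: each
      gives only a weak bound on \<open>f x\<close> or \<open>f y\<close>, and strictness comes from
      comparing their quotients.\<close>
    obtain n m where nm: "m < 2 ^ n" "x < real m / 2 ^ n" "real m / 2 ^ n < y"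
      using dense[of x y] xy by auto
    obtain n' m' where nm': "m' < 2 ^ n'" "real m / 2 ^ n < real m' / 2 ^ n'" "real m' / 2 ^ n' < y"
      using dense[of "real m / 2 ^ n" y] nm xy by auto
    have "f x \<le> stern_quot n m" unfolding f_def
      using ne[OF xy(1)] upper[OF _ nm(2,1)] by (intro cSup_least) (auto intro: less_imp_le)
    also have "\<dots> < stern_quot n' m'" by (rule stern_quot_less[OF nm'(2,1)])
    also have "\<dots> \<le> f y" unfolding f_def
      using nm' bdd[OF xy(2)] by (intro cSup_upper) (auto simp: V_def intro: less_imp_le)
    finally show ?thesis .
  qed
  then have "interpolates f" using dy by (auto simp: interpolates_def intro!: strict_mono_onI)
  then show ?thesis by blast
qed

lemma interpolates_assembly: "interpolates assembly"
proof -
  obtain f where f: "interpolates f" using interpolates_exists by blast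
  \<comment> \<open>Restriction leaves the values on \<open>[0, 1)\<close> alone and selects the one
    extensional representative, so the definite description is well defined.\<close>
  have "interpolates (restrict f {0..<1})"
    using f dyadic_in_unit by (auto simp: interpolates_def strict_mono_on_def)
  then have "\<exists>!g. g \<in> extensional {0..<1} \<and> interpolates g"
    by (intro ex1I[of _ "restrict f {0..<1}"]) (auto intro: extensionalityI interpolates_unique)
  then show ?thesis
    unfolding assembly_def is_assembly_iff_interpolates by (rule the1I2) simp
qed

lemmas assembly_nonneg = interpolates_nonneg[OF interpolates_assembly]
  and assembly_less_iff = interpolates_less_iff[OF interpolates_assembly]
  and assembly_eq_iff = interpolates_eq_iff[OF interpolates_assembly]
  and assembly_surj = interpolates_surj[OF interpolates_assembly]

section \<open>Functional equations\<close>

lemma assembly_dyadic: "m < 2 ^ n \<Longrightarrow> assembly (real m / 2 ^ n) = stern_quot n m"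
  using interpolates_assembly by (simp add: interpolates_def)

lemma assembly_half: "assembly (1 / 2) = 1"
  using assembly_dyadic[of 1 1] by (simp add: stern_quot_def)

text \<open>Solving the claimed equation for \<open>assembly x\<close> gives a function that again
  interpolates the Stern quotients, so uniqueness identifies the two.\<close>

lemma assembly_upper_half:
  assumes "x \<in> {0..<1}"
  shows "assembly ((1 + x) / 2) = 1 + assembly x"
proof -
  have "interpolates (\<lambda>x. assembly ((1 + x) / 2) - 1)"
    unfolding interpolates_def
  proof (intro conjI allI impI strict_mono_onI)
    fix n m :: nat assume m: "m < 2 ^ n"
    have "(1 + real m / 2 ^ n) / 2 = real (2 ^ n + m) / 2 ^ Suc n" by (simp add: field_simps)
    moreover have "2 ^ n + m < 2 ^ Suc n" using m by simp
    ultimately have "assembly ((1 + real m / 2 ^ n) / 2) = stern_quot (Suc n) (2 ^ n + m)"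
      using assembly_dyadic[of "2 ^ n + m" "Suc n"] by (simp only:)
    then show "assembly ((1 + real m / 2 ^ n) / 2) - 1 = stern_quot n m"
      using stern_quot_upper_half[OF m] by simp
  qed (simp add: assembly_less_iff)
  from interpolates_unique[OF this interpolates_assembly assms] show ?thesis by simp
qed

lemma assembly_lower_half:
  assumes "x \<in> {0..<1}"
  shows "assembly (x / 2) = assembly x / (1 + assembly x)"
proof -
  \<comment> \<open>The inverse of \<open>y / (1 + y)\<close>. It increases on arguments below 1,
    which is why \<open>lt1\<close> is established first.\<close>
  define g where "g y = y / (1 - y)" for y :: real
  have lt1: "assembly (y / 2) < 1" if "y \<in> {0..<1}" for y
    using assembly_less_iff[of "y / 2" "1 / 2"] assembly_half that by simp
  have "interpolates (\<lambda>x. g (assembly (x / 2)))"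
    unfolding interpolates_def
  proof (intro conjI allI impI strict_mono_onI)
    fix n m :: nat assume m: "m < 2 ^ n"
    have "real m / 2 ^ n / 2 = real m / 2 ^ Suc n" by (simp add: field_simps)
    moreover have "m < 2 ^ Suc n" using m by simp
    ultimately have "assembly (real m / 2 ^ n / 2) = stern_quot n m / (1 + stern_quot n m)"
      using assembly_dyadic[of m "Suc n"] stern_quot_lower_half[OF m] by (simp only:)
    then show "g (assembly (real m / 2 ^ n / 2)) = stern_quot n m"
      using stern_quot_nonneg[of n m] by (simp only: g_def) (simp add: divide_simps)
  next
    fix r s :: real assume rs: "r \<in> {0..<1}" "s \<in> {0..<1}" "r < s"
    have "assembly (r / 2) < assembly (s / 2)" using rs assembly_less_iff[of "r/2" "s/2"] by simp
    then show "g (assembly (r / 2)) < g (assembly (s / 2))"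
      using lt1[OF rs(1)] lt1[OF rs(2)] by (simp add: g_def divide_simps) (simp add: algebra_simps)
  qed
  from interpolates_unique[OF this interpolates_assembly assms]
  have "assembly x = assembly (x / 2) / (1 - assembly (x / 2))" by (simp add: g_def)
  then have "assembly x * (1 - assembly (x / 2)) = assembly (x / 2)"
    using lt1[OF assms] by simp
  then have "assembly (x / 2) * (1 + assembly x) = assembly x"
    by (simp add: algebra_simps)
  then show ?thesis using assembly_nonneg[OF assms] by (simp add: eq_divide_eq)
qed

text \<open>Every nonnegative rational is already a value at a dyadic point, and injectivity leaves
  no other preimage.\<close>

lemma assembly_rational_iff:
  assumes "x \<in> {0..<1}"
  shows "assembly x \<in> \<rat> \<longleftrightarrow> unit_dyadic x"
proof
  assume "assembly x \<in> \<rat>"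
  then obtain n m where nm: "m < 2 ^ n" "stern_quot n m = assembly x"
    using stern_quot_surj_Rats assembly_nonneg[OF assms] by metis
  then have "x = real m / 2 ^ n"
    using assembly_eq_iff[OF assms dyadic_in_unit[OF nm(1)]] assembly_dyadic by simp
  moreover have "m \<le> 2 ^ n - 1" using nm(1) by simp
  ultimately show "unit_dyadic x" unfolding unit_dyadic_def by blast
next
  assume "unit_dyadic x"
  then obtain n m where "m \<le> 2 ^ n - 1" "x = real m / 2 ^ n"
    unfolding unit_dyadic_def by blast
  moreover from this(1) have "m < 2 ^ n"
    by (simp only: le_2_power_minus_1_iff)
  ultimately show "assembly x \<in> \<rat>" using assembly_dyadic by (simp add: stern_quot_def)
qed

section \<open>The doubling map and binary digits\<close>

lemma frac_double: "frac (2 * x) = (if frac x < 1 / 2 then 2 * frac x else 2 * frac x - 1)"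
  for x :: real
proof -
  have "2 * x = 2 * of_int \<lfloor>x\<rfloor> + 2 * frac x" by (simp add: frac_def)
  then show ?thesis
    using frac_ge_0[of x] frac_lt_1[of x]
    by (auto simp: frac_unique_iff intro!: Ints_diff Ints_mult)
qed

lemma frac_double_power:
  "frac (2 ^ Suc k * x) =
    (if frac (2 ^ k * x) < 1 / 2 then 2 * frac (2 ^ k * x) else 2 * frac (2 ^ k * x) - 1)"
  for x :: real
  using frac_double[of "2 ^ k * x"] by (simp only: power_Suc mult.assoc)

lemma frac_in_unit: "frac x \<in> {0..<1}" for x :: real
  by (simp add: frac_lt_1)

lemma frac_power_frac: "frac (2 ^ k * frac x) = frac (2 ^ k * x)" for x :: real
proof (induction k)
  case (Suc k)
  show ?case unfolding frac_double_power Suc.IH ..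
qed simp

lemma frac_power_add: "frac (2 ^ (k + n) * x) = frac (2 ^ n * frac (2 ^ k * x))" for x :: real
  by (simp add: frac_power_frac power_add mult.assoc mult.left_commute)

lemma binary_digit_eq: "binary_digit x k = (if frac (2 ^ k * x) < 1 / 2 then 0 else 1)"
proof -
  define y where "y = 2 ^ k * x"
  have "\<lfloor>2 * y\<rfloor> = 2 * \<lfloor>y\<rfloor> + (if frac y < 1 / 2 then 0 else 1)"
    using frac_ge_0[of y] frac_lt_1[of y] by (auto simp: frac_def floor_eq_iff)
  then show ?thesis by (simp add: binary_digit_def y_def mult.assoc)
qed

text \<open>As long as the two orbits stay on the same side of 1/2, their distance doubles.\<close>

lemma frac_eq_if_same_digits:
  fixes x y :: real
  assumes "\<And>k. frac (2 ^ k * x) < 1 / 2 \<longleftrightarrow> frac (2 ^ k * y) < 1 / 2"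
  shows "frac x = frac y"
proof (rule ccontr)
  assume ne: "frac x \<noteq> frac y"
  have d: "frac (2 ^ k * x) - frac (2 ^ k * y) = 2 ^ k * (frac x - frac y)" for k
  proof (induction k)
    case (Suc k)
    show ?case unfolding frac_double_power using assms[of k] Suc.IH
      by (auto simp: algebra_simps)
  qed simp
  obtain k where "1 / \<bar>frac x - frac y\<bar> < 2 ^ k"
    using real_arch_pow[of 2 "1 / \<bar>frac x - frac y\<bar>"] by auto
  then have "1 < 2 ^ k * \<bar>frac x - frac y\<bar>" using ne by (simp add: field_simps)
  also have "\<dots> = \<bar>frac (2 ^ k * x) - frac (2 ^ k * y)\<bar>" by (simp add: d abs_mult)
  also have "\<dots> < 1"
    using frac_ge_0[of "2 ^ k * x"] frac_lt_1[of "2 ^ k * x"]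
      frac_ge_0[of "2 ^ k * y"] frac_lt_1[of "2 ^ k * y"] by linarith
  finally show False .
qed

text \<open>Doubling keeps the denominator of a rational bounded, so the orbit visits finitely many
  points. Conversely, a repetition is a nontrivial linear equation for \<open>x\<close> over the
  integers.\<close>

lemma rational_iff_doubling_orbit_repeats:
  fixes x :: real
  shows "x \<in> \<rat> \<longleftrightarrow> (\<exists>i j. i < j \<and> frac (2 ^ i * x) = frac (2 ^ j * x))"
proof
  assume "x \<in> \<rat>"
  then obtain u v :: int where v: "v > 0" and x: "x = of_int u / of_int v"
    by (metis Rats_cases')
  have "frac (2 ^ k * x) \<in> (\<lambda>m. of_int m / of_int v) ` {0..<v}" for k
  proof -
    \<comment> \<open>The remainder of \<open>2 ^ k * u\<close> modulo \<open>v\<close>.\<close>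
    define m where "m = 2 ^ k * u - v * \<lfloor>2 ^ k * x\<rfloor>"
    have e: "frac (2 ^ k * x) = of_int m / of_int v"
      using v by (simp add: frac_def m_def x field_simps)
    have "m \<ge> 0" "m < v"
      using frac_ge_0[of "2 ^ k * x"] frac_lt_1[of "2 ^ k * x"] v
      unfolding e by (simp_all add: divide_simps)
    then show ?thesis using e by auto
  qed
  then have "range (\<lambda>k. frac (2 ^ k * x)) \<subseteq> (\<lambda>m. of_int m / of_int v) ` {0..<v}" by blast
  then have "finite (range (\<lambda>k. frac (2 ^ k * x)))" by (rule finite_subset) simp
  then have "\<not> inj (\<lambda>k. frac (2 ^ k * x))" using finite_imageD infinite_UNIV_nat by blast
  then obtain i j where "i \<noteq> j" "frac (2 ^ i * x) = frac (2 ^ j * x)"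
    unfolding inj_on_def by blast
  then show "\<exists>i j. i < j \<and> frac (2 ^ i * x) = frac (2 ^ j * x)"
    by (metis linorder_neqE_nat)
next
  assume "\<exists>i j. i < j \<and> frac (2 ^ i * x) = frac (2 ^ j * x)"
  then obtain i j where ij: "i < j" "frac (2 ^ i * x) = frac (2 ^ j * x)" by blast
  have "(2::real) ^ i < 2 ^ j" using ij by simp
  moreover have "(2 ^ j - 2 ^ i) * x = of_int (\<lfloor>2 ^ j * x\<rfloor> - \<lfloor>2 ^ i * x\<rfloor>)"
    using ij(2) by (simp add: frac_def algebra_simps)
  ultimately have "x = of_int (\<lfloor>2 ^ j * x\<rfloor> - \<lfloor>2 ^ i * x\<rfloor>) / (2 ^ j - 2 ^ i)"
    by (simp add: eq_divide_eq mult.commute)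
  also have "\<dots> \<in> \<rat>" by (intro Rats_divide Rats_diff Rats_power Rats_of_int) auto
  finally show "x \<in> \<rat>" .
qed

section \<open>Binary expansions of rational and dyadic numbers\<close>

lemma rational_iff_eventually_periodic: "x \<in> \<rat> \<longleftrightarrow> eventually_periodic (binary_digit x)"
proof
  assume "x \<in> \<rat>"
  then obtain i j where ij: "i < j" "frac (2 ^ i * x) = frac (2 ^ j * x)"
    using rational_iff_doubling_orbit_repeats by blast
  have "binary_digit x (k + (j - i)) = binary_digit x k" if k: "k \<ge> i" for k
  proof -
    have e: "k + (j - i) = j + (k - i)" "k = i + (k - i)" using k ij(1) by auto
    have "frac (2 ^ (k + (j - i)) * x) = frac (2 ^ k * x)"
      by (subst e(1), subst (2) e(2)) (simp only: frac_power_add ij(2))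
    then show ?thesis by (simp only: binary_digit_eq)
  qed
  moreover have "j - i > 0" using ij(1) by simp
  ultimately show "eventually_periodic (binary_digit x)" unfolding eventually_periodic_def by blast
next
  assume "eventually_periodic (binary_digit x)"
  then obtain N p where p: "p > 0" and per: "\<And>k. k \<ge> N \<Longrightarrow> binary_digit x (k + p) = binary_digit x k"
    unfolding eventually_periodic_def by blast
  \<comment> \<open>Periodicity from \<open>N\<close> on says that these two orbit points have the
    same digits throughout.\<close>
  have "frac (2 ^ N * x) = frac (2 ^ (N + p) * x)"
  proof (rule frac_eq_if_same_digits)
    fix k
    have "binary_digit x (N + p + k) = binary_digit x (N + k)"
      using per[of "N + k"] by (simp add: add.commute add.left_commute)
    then have "frac (2 ^ (N + k) * x) < 1 / 2 \<longleftrightarrow> frac (2 ^ (N + p + k) * x) < 1 / 2"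
      unfolding binary_digit_eq by (auto split: if_splits)
    then show "frac (2 ^ k * (2 ^ N * x)) < 1 / 2 \<longleftrightarrow> frac (2 ^ k * (2 ^ (N + p) * x)) < 1 / 2"
      unfolding frac_power_add[of N k] frac_power_add[of "N + p" k] frac_power_frac .
  qed
  moreover have "N < N + p" using p by simp
  ultimately show "x \<in> \<rat>" using rational_iff_doubling_orbit_repeats by blast
qed

lemma unit_dyadic_iff_finite_expansion:
  assumes "x \<in> {0..<1}"
  shows "unit_dyadic x \<longleftrightarrow> finite_expansion (binary_digit x)"
proof
  assume "unit_dyadic x"
  then obtain n m :: nat where x: "x = real m / 2 ^ n" unfolding unit_dyadic_def by blast
  have "binary_digit x k = 0" if k: "k \<ge> n" for k
  proof -
    obtain d where "k = n + d" using k le_Suc_ex by blast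
    then have "2 ^ k * x = of_nat (2 ^ d * m)" by (simp add: x power_add)
    then have "frac (2 ^ k * x) = 0" by (simp only: frac_eq_0_iff Ints_of_nat)
    then show ?thesis by (simp only: binary_digit_eq) simp
  qed
  then show "finite_expansion (binary_digit x)" unfolding finite_expansion_def by blast
next
  assume "finite_expansion (binary_digit x)"
  then obtain N where N: "\<And>k. k \<ge> N \<Longrightarrow> binary_digit x k = 0" unfolding finite_expansion_def by blast
  \<comment> \<open>All digits from \<open>N\<close> on agree with those of 0, so
    \<open>2 ^ N * x\<close> is an integer.\<close>
  have "frac (2 ^ N * x) = frac 0"
  proof (rule frac_eq_if_same_digits)
    fix k
    have "frac (2 ^ (N + k) * x) < 1 / 2"
      using N[of "N + k"] unfolding binary_digit_eq by (auto split: if_splits)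
    then show "frac (2 ^ k * (2 ^ N * x)) < 1 / 2 \<longleftrightarrow> frac (2 ^ k * (0::real)) < 1 / 2"
      unfolding frac_power_add[of N k] frac_power_frac by simp
  qed
  then have e: "2 ^ N * x = of_int \<lfloor>2 ^ N * x\<rfloor>" by (simp add: frac_def)
  define m where "m = nat \<lfloor>2 ^ N * x\<rfloor>"
  have "real m = 2 ^ N * x" using e assms by (simp add: m_def)
  moreover from this have "real m < real (2 ^ N)" using assms by simp
  ultimately have "x = real m / 2 ^ N" "m < 2 ^ N" by (simp_all only: of_nat_less_iff) simp_all
  then show "unit_dyadic x" unfolding unit_dyadic_def le_2_power_minus_1_iff by blast
qed

lemma assembly_frac_double:
  assumes "x \<in> {0..<1}"
  shows "assembly (frac (2 * x)) = (if x < 1 / 2 then assembly x / (1 - assembly x) else assembly x - 1)"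
proof -
  have fx: "frac x = x" using assms by (simp add: frac_eq)
  show ?thesis
  proof (cases "x < 1 / 2")
    case True
    then have u: "2 * x \<in> {0..<1}" using assms by simp
    have "assembly x = assembly (2 * x) / (1 + assembly (2 * x))"
      using assembly_lower_half[OF u] by simp
    then show ?thesis
      using True assembly_nonneg[OF u] by (simp add: frac_double fx) (simp add: divide_simps)
  next
    case False
    then have u: "2 * x - 1 \<in> {0..<1}" using assms by simp
    show ?thesis using assembly_upper_half[OF u] False by (simp add: frac_double fx)
  qed
qed

text \<open>The inverse branches of \<open>assembly_frac_double\<close>; their coefficients are
  nonnegative, which the matrix products below rely on.\<close>

lemma assembly_unfold:
  assumes "x \<in> {0..<1}"
  shows "assembly x = (if x < 1 / 2 then assembly (frac (2 * x)) / (1 + assembly (frac (2 * x)))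
    else 1 + assembly (frac (2 * x)))"
proof -
  have fx: "frac x = x" using assms by (simp add: frac_eq)
  show ?thesis
    using assembly_lower_half[of "2 * x"] assembly_upper_half[of "2 * x - 1"] assms
    by (simp add: frac_double fx)
qed

section \<open>Rational angles have quadratic images\<close>

text \<open>The matrix with rows \<open>a b\<close> and \<open>c d\<close> is a product of
  \<open>p\<close> elementary matrices, one for each binary digit. The lower bound on the entry sum
  records that it is not the identity once \<open>p > 0\<close>.\<close>

lemma assembly_moebius_orbit:
  assumes x: "x \<in> {0..<1}"
  shows "\<exists>a b c d :: int. a \<ge> 0 \<and> b \<ge> 0 \<and> c \<ge> 0 \<and> d \<ge> 0 \<and> a * d - b * c = 1 \<and>
    a + b + c + d \<ge> 2 + int p \<and>
    assembly x * (of_int c * assembly (frac (2 ^ p * x)) + of_int d) =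
      of_int a * assembly (frac (2 ^ p * x)) + of_int b"
proof (induction p)
  case 0
  have "frac x = x" using x by (simp add: frac_eq)
  then show ?case by (intro exI[of _ 1] exI[of _ 0]) (simp add: exI[of _ 0] exI[of _ 1])
next
  case (Suc p)
  then obtain a b c d :: int where *: "a \<ge> 0" "b \<ge> 0" "c \<ge> 0" "d \<ge> 0" "a * d - b * c = 1"
    "a + b + c + d \<ge> 2 + int p"
    "assembly x * (of_int c * assembly (frac (2 ^ p * x)) + of_int d) =
      of_int a * assembly (frac (2 ^ p * x)) + of_int b" by blast
  define t where "t = frac (2 ^ p * x)"
  define y where "y = assembly (frac (2 ^ Suc p * x))"
  have y0: "y \<ge> 0" unfolding y_def by (rule assembly_nonneg[OF frac_in_unit])
  have "frac (2 ^ Suc p * x) = frac (2 * t)"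
    using frac_power_frac[of 1 "2 ^ p * x"] by (simp add: t_def mult.assoc)
  then have t: "assembly t = (if t < 1 / 2 then y / (1 + y) else 1 + y)"
    using assembly_unfold[of t] by (simp add: y_def t_def frac_lt_1)
  have eq: "assembly x * (of_int c * assembly t + of_int d) = of_int a * assembly t + of_int b"
    using *(7) by (simp add: t_def)
  have "a \<noteq> 0 \<or> c \<noteq> 0" "b \<noteq> 0 \<or> d \<noteq> 0" using *(5) by auto
  \<comment> \<open>Both columns have positive sum, so adding one column to the other raises the
    entry sum by at least 1.\<close>
  then have ac: "a + c \<ge> 1" "b + d \<ge> 1" using *(1-4) by linarith+
  show ?case
  proof (cases "t < 1 / 2")
    case True
    have v: "assembly t * (1 + y) = y" using t True y0 by simp
    have "assembly x * (of_int c * (assembly t * (1 + y)) + of_int d * (1 + y))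
        = of_int a * (assembly t * (1 + y)) + of_int b * (1 + y)"
      using arg_cong[OF eq, of "\<lambda>z. z * (1 + y)"] by (simp add: algebra_simps)
    then have "assembly x * (of_int (c + d) * y + of_int d) = of_int (a + b) * y + of_int b"
      unfolding v by (simp add: algebra_simps)
    moreover have "(a + b) * d - b * (c + d) = 1" using *(5) by (simp add: algebra_simps)
    ultimately show ?thesis unfolding y_def[symmetric] using *(1-4,6) ac
      by (intro exI[of _ "a + b"] exI[of _ b] exI[of _ "c + d"] exI[of _ d]) auto
  next
    case False
    have "assembly x * (of_int c * y + of_int (c + d)) = of_int a * y + of_int (a + b)"
      using eq t False by (simp add: algebra_simps)
    moreover have "a * (c + d) - (a + b) * c = 1" using *(5) by (simp add: algebra_simps)
    ultimately show ?thesis unfolding y_def[symmetric] using *(1-4,6) ac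
      by (intro exI[of _ a] exI[of _ "a + b"] exI[of _ c] exI[of _ "c + d"]) auto
  qed
qed

lemma quadratic_irrational_if_periodic:
  assumes x: "x \<in> {0..<1}" and "p > 0" and per: "frac (2 ^ p * x) = x" and irr: "assembly x \<notin> \<rat>"
  shows "quadratic_irrational (assembly x)"
proof -
  define w where "w = assembly x"
  obtain a b c d :: int where *: "a \<ge> 0" "b \<ge> 0" "c \<ge> 0" "d \<ge> 0" "a * d - b * c = 1"
    "a + b + c + d \<ge> 2 + int p" "w * (of_int c * w + of_int d) = of_int a * w + of_int b"
    using assembly_moebius_orbit[OF x, of p] unfolding per w_def by blast
  have eq: "of_int c * w\<^sup>2 + of_int (d - a) * w + of_int (- b) = 0"
    using *(7) by (simp add: algebra_simps power2_eq_square)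
  \<comment> \<open>Otherwise the determinant forces \<open>a = d = 1\<close>, the fixed-point
    equation forces \<open>b = 0\<close>, and the entry sum 2 is too small.\<close>
  have "c \<noteq> 0"
  proof
    assume c: "c = 0"
    then have "a * d = 1" using *(5) by simp
    then have ad: "a = 1" "d = 1" using *(1) by (auto simp: zmult_eq_1_iff)
    then have "b = 0" using eq c by simp
    then show False using *(6) ad c \<open>p > 0\<close> by simp
  qed
  then show ?thesis using eq irr unfolding quadratic_irrational_def w_def by blast
qed

section \<open>Quadratic irrationality along the inverse branches\<close>

lemma quadratic_irrational_add_1:
  assumes "quadratic_irrational y"
  shows "quadratic_irrational (1 + y)"
proof -
  obtain a b c :: int where *: "y \<notin> \<rat>" "a \<noteq> 0" "of_int a * y\<^sup>2 + of_int b * y + of_int c = 0"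
    using assms unfolding quadratic_irrational_def by blast
  have "1 + y \<notin> \<rat>" using *(1) Rats_diff[of "1 + y" 1] by auto
  moreover have "of_int a * (1 + y)\<^sup>2 + of_int (b - 2 * a) * (1 + y) + of_int (a - b + c) = 0"
    using *(3) by (simp add: algebra_simps power2_eq_square)
  ultimately show ?thesis using *(2) unfolding quadratic_irrational_def by blast
qed

lemma quadratic_irrational_div_1_plus:
  assumes "quadratic_irrational y"
  shows "quadratic_irrational (y / (1 + y))"
proof -
  obtain a b c :: int where *: "y \<notin> \<rat>" "a \<noteq> 0" "of_int a * y\<^sup>2 + of_int b * y + of_int c = 0"
    using assms unfolding quadratic_irrational_def by blast
  have y1: "1 + y \<noteq> 0" using *(1) by (metis Rats_1 Rats_minus_iff add_eq_0_iff)
  define x where "x = y / (1 + y)"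
  have x1: "1 - x \<noteq> 0" "y = x / (1 - x)" using y1 by (simp_all add: x_def field_simps)
  have "x \<notin> \<rat>"
  proof
    assume "x \<in> \<rat>"
    then have "x / (1 - x) \<in> \<rat>" by simp
    then show False using *(1) x1 by simp
  qed
  moreover have "of_int (a - b + c) * x\<^sup>2 + of_int (b - 2 * c) * x + of_int c = 0"
  proof -
    \<comment> \<open>Denominators are cleared by \<open>(1 - x)^2\<close>, after which
      \<open>y * (1 - x) = x\<close> eliminates \<open>y\<close>.\<close>
    have "of_int a * y\<^sup>2 * (1 - x)\<^sup>2 + of_int b * y * (1 - x)\<^sup>2 + of_int c * (1 - x)\<^sup>2 = 0"
      using *(3) by (metis distrib_right mult_zero_left)
    moreover have "y * (1 - x) = x" using x1 by simp
    then have "(y * (1 - x))\<^sup>2 = x\<^sup>2" "y * (1 - x) * (1 - x) = x * (1 - x)" by simp_all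
    then have "y\<^sup>2 * (1 - x)\<^sup>2 = x\<^sup>2" "y * (1 - x)\<^sup>2 = x * (1 - x)"
      by (simp_all only: power2_eq_square mult_ac)
    ultimately have "of_int a * x\<^sup>2 + of_int b * (x * (1 - x)) + of_int c * (1 - x)\<^sup>2 = 0"
      by (simp add: mult.assoc)
    then show ?thesis by (simp add: power2_eq_square algebra_simps)
  qed
  \<comment> \<open>The new leading coefficient is the old polynomial at -1; if it vanished, the
    other root would be rational and equal to \<open>y\<close>.\<close>
  moreover have "a - b + c \<noteq> 0"
  proof
    assume "a - b + c = 0"
    then have "b = a + c" by simp
    then have "(1 + y) * (of_int a * y + of_int c) = 0"
      using *(3) by (simp add: algebra_simps power2_eq_square)
    then have "of_int a * y = - of_int c" using y1 by (simp add: eq_neg_iff_add_eq_0)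
    then have "y = - of_int c / of_int a" using *(2) by (simp add: field_simps)
    then show False using *(1) by simp
  qed
  ultimately show ?thesis unfolding quadratic_irrational_def x_def by blast
qed

lemma quadratic_irrational_if_orbit:
  assumes x: "x \<in> {0..<1}" and "quadratic_irrational (assembly (frac (2 ^ k * x)))"
  shows "quadratic_irrational (assembly x)"
  using assms(2)
proof (induction k)
  case 0
  then show ?case using x by (simp add: frac_eq)
next
  case (Suc k)
  have "frac (2 * frac (2 ^ k * x)) = frac (2 ^ Suc k * x)"
    using frac_power_frac[of 1 "2 ^ k * x"] by (simp add: mult.assoc)
  then have "quadratic_irrational (assembly (frac (2 ^ k * x)))"
    using assembly_unfold[OF frac_in_unit, of "2 ^ k * x"] Suc.prems
      quadratic_irrational_add_1 quadratic_irrational_div_1_plus by (auto split: if_splits)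
  then show ?case by (rule Suc.IH)
qed

text \<open>The digits of an orbit point are a tail of the digits of \<open>x\<close>, and
  finiteness depends only on a tail.\<close>

lemma unit_dyadic_frac:
  assumes x: "x \<in> {0..<1}" and "unit_dyadic (frac (2 ^ k * x))"
  shows "unit_dyadic x"
proof -
  obtain N where N: "\<And>j. j \<ge> N \<Longrightarrow> binary_digit (frac (2 ^ k * x)) j = 0"
    using assms(2) unit_dyadic_iff_finite_expansion[OF frac_in_unit]
    unfolding finite_expansion_def by blast
  have "binary_digit x j = 0" if j: "j \<ge> k + N" for j
  proof -
    have "j = k + (j - k)" using j by simp
    then have "binary_digit x j = binary_digit (frac (2 ^ k * x)) (j - k)"
      unfolding binary_digit_eq by (metis frac_power_add)
    then show ?thesis using N[of "j - k"] j by simp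
  qed
  then show ?thesis
    using unit_dyadic_iff_finite_expansion[OF x] unfolding finite_expansion_def by blast
qed

lemma quadratic_irrational_if_rational:
  assumes x: "x \<in> {0..<1}" and "x \<in> \<rat>" and nd: "\<not> unit_dyadic x"
  shows "quadratic_irrational (assembly x)"
proof -
  obtain i j where ij: "i < j" "frac (2 ^ i * x) = frac (2 ^ j * x)"
    using rational_iff_doubling_orbit_repeats assms(2) by blast
  \<comment> \<open>Past the preperiod, the orbit point is genuinely periodic with period
    \<open>j - i\<close>.\<close>
  have "frac (2 ^ (j - i) * frac (2 ^ i * x)) = frac (2 ^ i * x)"
    using frac_power_add[of i "j - i" x] ij by simp
  moreover have "assembly (frac (2 ^ i * x)) \<notin> \<rat>"
    using assembly_rational_iff[OF frac_in_unit] unit_dyadic_frac[OF x] nd by blast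
  ultimately have "quadratic_irrational (assembly (frac (2 ^ i * x)))"
    using ij by (intro quadratic_irrational_if_periodic[OF frac_in_unit, of "j - i"]) auto
  then show ?thesis by (rule quadratic_irrational_if_orbit[OF x])
qed

section \<open>Quadratic values come from rational angles\<close>

text \<open>The polynomial is existentially hidden and need not be primitive, so \<open>x\<close>
  does not determine \<open>D\<close>. Only the discriminant is exposed, as the quantity that stays
  constant along the orbit.\<close>

definition conjugates :: "int \<Rightarrow> real \<Rightarrow> real \<Rightarrow> bool" where
  "conjugates D x y \<longleftrightarrow> x \<notin> \<rat> \<and> y \<notin> \<rat> \<and> x \<noteq> y \<and>
     (\<exists>a b c :: int. a \<noteq> 0 \<and> b\<^sup>2 - 4 * a * c = D \<and>
        of_int a * x\<^sup>2 + of_int b * x + of_int c = 0 \<and> of_int a * y\<^sup>2 + of_int b * y + of_int c = 0)"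

lemma quadratic_irrational_conjugates:
  assumes "quadratic_irrational x"
  obtains D y where "conjugates D x y"
proof -
  obtain a b c :: int where *: "x \<notin> \<rat>" "a \<noteq> 0" "of_int a * x\<^sup>2 + of_int b * x + of_int c = 0"
    using assms unfolding quadratic_irrational_def by blast
  \<comment> \<open>The other root, from the sum of the roots. It differs from \<open>x\<close>,
    since a double root would be rational.\<close>
  define y where "y = - of_int b / of_int a - x"
  have ay: "of_int a * y = - of_int b - of_int a * x" using *(2) by (simp add: y_def field_simps)
  have "of_int a * y\<^sup>2 + of_int b * y + of_int c = (of_int a * y + of_int b) * y + of_int c"
    by (simp add: power2_eq_square algebra_simps)
  also have "\<dots> = - x * (of_int a * y) + of_int c" by (simp add: ay)
  also have "\<dots> = 0"
    unfolding ay using *(3) by (simp add: algebra_simps power2_eq_square)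
  finally have ry: "of_int a * y\<^sup>2 + of_int b * y + of_int c = 0" .
  have "y \<notin> \<rat>"
  proof
    assume "y \<in> \<rat>"
    then have "- of_int b / of_int a - y \<in> \<rat>" by simp
    then show False using *(1) by (simp add: y_def)
  qed
  moreover have "x \<noteq> y"
  proof
    assume "x = y"
    then have "x = - of_int b / of_int a / 2" by (simp add: y_def)
    then show False using *(1) by simp
  qed
  ultimately show ?thesis using that[of "b\<^sup>2 - 4 * a * c" y] * ry unfolding conjugates_def by blast
qed

lemma conjugates_minus_1:
  assumes "conjugates D x y"
  shows "conjugates D (x - 1) (y - 1)"
proof -
  obtain a b c :: int where *: "x \<notin> \<rat>" "y \<notin> \<rat>" "x \<noteq> y" "a \<noteq> 0" "b\<^sup>2 - 4 * a * c = D"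
    "of_int a * x\<^sup>2 + of_int b * x + of_int c = 0" "of_int a * y\<^sup>2 + of_int b * y + of_int c = 0"
    using assms unfolding conjugates_def by blast
  have irr: "z - 1 \<notin> \<rat>" if "z \<notin> \<rat>" for z :: real using that Rats_add[of "z - 1" 1] by auto
  have root: "of_int a * (z - 1)\<^sup>2 + of_int (2 * a + b) * (z - 1) + of_int (a + b + c) = 0"
    if "of_int a * z\<^sup>2 + of_int b * z + of_int c = 0" for z :: real
    using that by (simp add: algebra_simps power2_eq_square)
  have "(2 * a + b)\<^sup>2 - 4 * a * (a + b + c) = D"
    using *(5) by (simp add: algebra_simps power2_eq_square)
  moreover have "x - 1 \<noteq> y - 1" using *(3) by simp
  ultimately show ?thesis unfolding conjugates_def
    using irr[OF *(1)] irr[OF *(2)] *(4) root[OF *(6)] root[OF *(7)] by blast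
qed

lemma conjugates_div_1_minus:
  assumes "conjugates D x y"
  shows "conjugates D (x / (1 - x)) (y / (1 - y))"
proof -
  obtain a b c :: int where *: "x \<notin> \<rat>" "y \<notin> \<rat>" "x \<noteq> y" "a \<noteq> 0" "b\<^sup>2 - 4 * a * c = D"
    "of_int a * x\<^sup>2 + of_int b * x + of_int c = 0" "of_int a * y\<^sup>2 + of_int b * y + of_int c = 0"
    using assms unfolding conjugates_def by blast
  have ne1: "1 - z \<noteq> 0" if "z \<notin> \<rat>" for z :: real using that by auto
  \<comment> \<open>Invertibility of the map gives both irrationality and distinctness of the
    images.\<close>
  have inv: "z = z / (1 - z) / (1 + z / (1 - z))" if "z \<notin> \<rat>" for z :: real
    using ne1[OF that] by (simp add: field_simps)
  have irr: "z / (1 - z) \<notin> \<rat>" if "z \<notin> \<rat>" for z :: real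
  proof
    assume "z / (1 - z) \<in> \<rat>"
    from Rats_divide[OF this Rats_add[OF Rats_1 this]]
    show False using inv[OF that] that by simp
  qed
  have root: "of_int (a + b + c) * (z / (1 - z))\<^sup>2 + of_int (b + 2 * c) * (z / (1 - z)) + of_int c = 0"
    if z: "z \<notin> \<rat>" "of_int a * z\<^sup>2 + of_int b * z + of_int c = 0" for z :: real
  proof -
    define v where "v = z / (1 - z)"
    have v: "v * (1 - z) = z" using ne1[OF z(1)] by (simp add: v_def)
    have "(of_int (a + b + c) * v\<^sup>2 + of_int (b + 2 * c) * v + of_int c) * (1 - z)\<^sup>2 =
        of_int (a + b + c) * (v * (1 - z))\<^sup>2 + of_int (b + 2 * c) * (v * (1 - z) * (1 - z))
        + of_int c * (1 - z)\<^sup>2"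
      unfolding power2_eq_square by algebra
    also have "\<dots> = of_int a * z\<^sup>2 + of_int b * z + of_int c"
      unfolding v by (simp add: algebra_simps power2_eq_square)
    finally show ?thesis using z(2) ne1[OF z(1)] unfolding v_def[symmetric] by simp
  qed
  \<comment> \<open>This is the polynomial at 1; if it vanished, the factor \<open>1 - x\<close>
    would split off and leave a rational root.\<close>
  have "a + b + c \<noteq> 0"
  proof
    assume "a + b + c = 0"
    then have b: "b = - a - c" by simp
    then have "(1 - x) * (of_int c - of_int a * x) = 0"
      using *(6) unfolding b by (simp add: algebra_simps power2_eq_square)
    then have "of_int a * x = of_int c" using ne1[OF *(1)] by simp
    then have "x = of_int c / of_int a" using *(4) by (simp add: eq_divide_eq mult.commute)
    then show False using *(1) by simp
  qed
  moreover have "(b + 2 * c)\<^sup>2 - 4 * (a + b + c) * c = D"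
    using *(5) by (simp add: algebra_simps power2_eq_square)
  moreover have "x / (1 - x) \<noteq> y / (1 - y)" using inv[OF *(1)] inv[OF *(2)] *(3) by metis
  ultimately show ?thesis unfolding conjugates_def
    using irr[OF *(1)] irr[OF *(2)] root[OF *(1,6)] root[OF *(2,7)] by blast
qed

text \<open>The digit of \<open>x\<close> alone selects the branch, and the conjugate is carried
  along by the same map whatever its own position.\<close>

lemma conjugates_orbit_step:
  assumes "conjugates D (assembly (frac (2 ^ k * x))) y"
  shows "conjugates D (assembly (frac (2 ^ Suc k * x)))
    (if frac (2 ^ k * x) < 1 / 2 then y / (1 - y) else y - 1)"
proof -
  have "frac (2 * frac (2 ^ k * x)) = frac (2 ^ Suc k * x)"
    using frac_power_frac[of 1 "2 ^ k * x"] by (simp add: mult.assoc)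
  then show ?thesis
    using assembly_frac_double[OF frac_in_unit, of "2 ^ k * x"]
      conjugates_minus_1[OF assms] conjugates_div_1_minus[OF assms] by auto
qed

text \<open>A positive conjugate is itself a value of the assembly function, at some other angle. The
  two angles have different binary digits somewhere, and there the conjugate turns negative.\<close>

lemma conjugate_eventually_negative:
  assumes "conjugates D (assembly x) y" and x: "x \<in> {0..<1}"
  shows "\<exists>k. \<exists>y'<0. conjugates D (assembly (frac (2 ^ k * x))) y'"
proof (rule ccontr)
  assume none: "\<not> (\<exists>k. \<exists>y'<0. conjugates D (assembly (frac (2 ^ k * x))) y')"
  have nonneg: "0 \<le> y'" if "conjugates D (assembly (frac (2 ^ k * x))) y'" for k y'
    using none that by (meson not_less)
  have fx: "frac x = x" using x by (simp add: frac_eq)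
  have "0 \<le> y" using nonneg[of 0 y] assms(1) fx by simp
  then obtain z where z: "z \<in> {0..<1}" "assembly z = y" using assembly_surj by blast
  have fz: "frac z = z" using z by (simp add: frac_eq)
  have step: "(frac (2 ^ k * x) < 1 / 2 \<longleftrightarrow> frac (2 ^ k * z) < 1 / 2) \<and>
      conjugates D (assembly (frac (2 ^ Suc k * x))) (assembly (frac (2 ^ Suc k * z)))"
    if c: "conjugates D (assembly (frac (2 ^ k * x))) (assembly (frac (2 ^ k * z)))" for k
  proof -
    define u where "u = frac (2 ^ k * z)"
    have u: "u \<in> {0..<1}" unfolding u_def by (rule frac_in_unit)
    have "frac (2 * u) = frac (2 ^ Suc k * z)"
      using frac_power_frac[of 1 "2 ^ k * z"] by (simp add: u_def mult.assoc)
    then have next_u: "assembly (frac (2 ^ Suc k * z)) =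
        (if u < 1 / 2 then assembly u / (1 - assembly u) else assembly u - 1)"
      using assembly_frac_double[OF u] by simp
    have irr: "assembly u \<notin> \<rat>" using c unfolding conjugates_def u_def by blast
    have half: "u < 1 / 2 \<longleftrightarrow> assembly u < 1"
      using assembly_less_iff[OF u, of "1 / 2"] assembly_half by simp
    have ne: "assembly u \<noteq> 1" "assembly u \<noteq> 0" using irr by auto
    have pos: "assembly u > 0" using ne assembly_nonneg[OF u] by simp
    have nn: "0 \<le> (if frac (2 ^ k * x) < 1 / 2 then assembly u / (1 - assembly u) else assembly u - 1)"
      using nonneg[OF conjugates_orbit_step[OF c]] by (simp only: u_def)
    \<comment> \<open>Were \<open>u\<close> on the other side of 1/2, the branch selected by
      \<open>x\<close> would send the conjugate below 0, against \<open>nn\<close>.\<close>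
    have same: "frac (2 ^ k * x) < 1 / 2 \<longleftrightarrow> u < 1 / 2"
    proof (cases "frac (2 ^ k * x) < 1 / 2")
      case True
      then have "assembly u < 1" using nn pos ne by (simp add: zero_le_divide_iff)
      then show ?thesis using half True by simp
    next
      case False
      then show ?thesis using nn half by simp
    qed
    show ?thesis using conjugates_orbit_step[OF c] same
      unfolding u_def[symmetric] next_u by simp
  qed
  have all: "conjugates D (assembly (frac (2 ^ k * x))) (assembly (frac (2 ^ k * z)))" for k
  proof (induction k)
    case 0
    then show ?case using assms(1) fx fz z by simp
  next
    case (Suc k)
    then show ?case using step by blast
  qed
  have "frac x = frac z" by (rule frac_eq_if_same_digits) (use step[OF all] in blast)
  then have "assembly x = y" using fx fz z by simp
  then show False using assms(1) unfolding conjugates_def by blast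
qed

section \<open>Finiteness for roots of opposite sign\<close>

lemma finite_quadratic_roots:
  fixes a b c :: real
  assumes "a \<noteq> 0"
  shows "finite {x. a * x\<^sup>2 + b * x + c = 0}"
proof -
  have "{x. a * x\<^sup>2 + b * x + c = 0} \<subseteq>
      {(- b + sqrt (discrim a b c)) / (2 * a), (- b - sqrt (discrim a b c)) / (2 * a)}"
    using discriminant_iff[OF assms] by auto
  then show ?thesis by (rule finite_subset) simp
qed

text \<open>Conjugates of opposite signs force a * c < 0, so D = b^2 - 4 * a * c bounds all three
  coefficients.\<close>

lemma finite_conjugates_opposite_sign: "finite {x. x \<ge> 0 \<and> (\<exists>y<0. conjugates D x y)}"
proof -
  define R where "R = (\<lambda>(a::int, b::int, c::int).
    {x::real. a \<noteq> 0 \<and> of_int a * x\<^sup>2 + of_int b * x + of_int c = 0})"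
  define B where "B = {- D..D} \<times> {- D..D} \<times> {- D..D}"
  have "finite (R t)" for t
  proof -
    obtain a b c where t: "t = (a, b, c)" by (cases t)
    show ?thesis
    proof (cases "a = 0")
      case True
      then show ?thesis by (simp add: R_def t)
    next
      case False
      then show ?thesis
        using finite_quadratic_roots[of "of_int a" "of_int b" "of_int c"] by (simp add: R_def t)
    qed
  qed
  then have "finite (\<Union>t\<in>B. R t)" by (simp add: B_def)
  moreover have "{x. x \<ge> 0 \<and> (\<exists>y<0. conjugates D x y)} \<subseteq> (\<Union>t\<in>B. R t)"
  proof
    fix x assume "x \<in> {x. x \<ge> 0 \<and> (\<exists>y<0. conjugates D x y)}"
    then obtain y where x0: "x \<ge> 0" and y: "y < 0" "conjugates D x y" by blast
    then obtain a b c :: int where *: "x \<notin> \<rat>" "x \<noteq> y" "a \<noteq> 0" "b\<^sup>2 - 4 * a * c = D"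
      "of_int a * x\<^sup>2 + of_int b * x + of_int c = 0" "of_int a * y\<^sup>2 + of_int b * y + of_int c = 0"
      unfolding conjugates_def by blast
    have x: "x > 0" using x0 *(1) by (cases "x = 0") auto
    \<comment> \<open>Subtracting the two equations and cancelling \<open>x - y\<close> gives
      Vieta's formulas for \<open>b\<close> and \<open>c\<close>.\<close>
    have "(x - y) * (of_int a * (x + y) + of_int b) = 0"
      using *(5,6) by (simp add: algebra_simps power2_eq_square)
    then have b: "of_int b = - of_int a * (x + y)" using *(2) by auto
    have c: "of_int c = of_int a * (x * y)"
      using *(5) unfolding b by (simp add: algebra_simps power2_eq_square)
    have "of_int (a * c) = (of_int a)\<^sup>2 * (x * y)" by (simp add: c power2_eq_square)
    also have "\<dots> < 0" using *(3) x y(1) by (simp add: mult_pos_neg)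
    finally have ac: "a * c < 0" by (simp only: of_int_less_0_iff)
    have c0: "c \<noteq> 0" using ac by auto
    have D: "D = b\<^sup>2 + 4 * (\<bar>a\<bar> * \<bar>c\<bar>)" using *(4) ac by (simp add: abs_mult[symmetric])
    have "\<bar>a\<bar> * 1 \<le> \<bar>a\<bar> * \<bar>c\<bar>" "1 * \<bar>c\<bar> \<le> \<bar>a\<bar> * \<bar>c\<bar>"
      using *(3) c0 by (intro mult_left_mono mult_right_mono; simp)+
    moreover have "\<bar>b\<bar> \<le> b\<^sup>2"
      using mult_left_mono[of 1 "\<bar>b\<bar>" "\<bar>b\<bar>"] by (cases "b = 0") (auto simp: power2_eq_square)
    moreover have "b\<^sup>2 \<ge> 0" "\<bar>a\<bar> * \<bar>c\<bar> \<ge> 0" by auto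
    ultimately have "\<bar>a\<bar> \<le> D" "\<bar>b\<bar> \<le> D" "\<bar>c\<bar> \<le> D" unfolding D by linarith+
    then have "(a, b, c) \<in> B" by (auto simp: B_def)
    moreover have "x \<in> R (a, b, c)" using * by (simp add: R_def)
    ultimately show "x \<in> (\<Union>t\<in>B. R t)" by blast
  qed
  ultimately show ?thesis using finite_subset by blast
qed

lemma rational_if_quadratic_irrational:
  assumes x: "x \<in> {0..<1}" and q: "quadratic_irrational (assembly x)"
  shows "x \<in> \<rat>"
proof -
  obtain D y where "conjugates D (assembly x) y" using quadratic_irrational_conjugates[OF q] .
  then obtain k y0 where k: "conjugates D (assembly (frac (2 ^ k * x))) y0" "y0 < 0"
    using conjugate_eventually_negative x by metis
  \<comment> \<open>Both branches \<open>y / (1 - y)\<close> and \<open>y - 1\<close> send negative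
    numbers to negative numbers, so the sign persists from step \<open>k\<close> on.\<close>
  have neg: "\<exists>y<0. conjugates D (assembly (frac (2 ^ (k + n) * x))) y" for n
  proof (induction n)
    case 0
    then show ?case using k by auto
  next
    case (Suc n)
    then obtain y where y: "y < 0" "conjugates D (assembly (frac (2 ^ (k + n) * x))) y" by blast
    have "(if frac (2 ^ (k + n) * x) < 1 / 2 then y / (1 - y) else y - 1) < 0"
      using y(1) by (simp add: divide_neg_pos)
    then show ?case using conjugates_orbit_step[OF y(2)] by (metis add_Suc_right)
  qed
  define h where "h n = frac (2 ^ (k + n) * x)" for n
  have "(\<lambda>n. assembly (h n)) ` UNIV \<subseteq> {x. x \<ge> 0 \<and> (\<exists>y<0. conjugates D x y)}"
    using neg assembly_nonneg[OF frac_in_unit] by (auto simp: h_def)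
  then have "finite (range (\<lambda>n. assembly (h n)))"
    using finite_conjugates_opposite_sign by (rule finite_subset)
  \<comment> \<open>Infinitely many steps share finitely many values; injectivity of the assembly
    function turns a repeated value into a repeated angle.\<close>
  then have "\<not> inj (\<lambda>n. assembly (h n))" using finite_imageD infinite_UNIV_nat by blast
  then obtain i j where "i \<noteq> j" "assembly (h i) = assembly (h j)"
    unfolding inj_on_def by blast
  then have ij: "k + i \<noteq> k + j" "frac (2 ^ (k + i) * x) = frac (2 ^ (k + j) * x)"
    using assembly_eq_iff[OF frac_in_unit frac_in_unit] by (auto simp: h_def)
  then show ?thesis
    unfolding rational_iff_doubling_orbit_repeats by (metis linorder_neqE_nat)
qed

theorem theorem7p4:
  fixes \<theta> \<omega> :: real
  assumes "\<theta> \<in> {0..<1}" and "\<omega> = assembly \<theta>"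
  shows "(\<omega> \<in> \<rat> \<longleftrightarrow> unit_dyadic \<theta>) \<and>
    (quadratic_irrational \<omega> \<longleftrightarrow> \<theta> \<in> \<rat> \<and> \<not> unit_dyadic \<theta>) \<and>
    (\<theta> \<in> \<rat> \<and> \<not> unit_dyadic \<theta> \<longleftrightarrow>
      eventually_periodic (binary_digit \<theta>) \<and> \<not> finite_expansion (binary_digit \<theta>))"
proof (intro conjI)
  show rat: "\<omega> \<in> \<rat> \<longleftrightarrow> unit_dyadic \<theta>"
    using assembly_rational_iff assms by blast
  show "quadratic_irrational \<omega> \<longleftrightarrow> \<theta> \<in> \<rat> \<and> \<not> unit_dyadic \<theta>"
    using quadratic_irrational_if_rational rational_if_quadratic_irrational rat assms
    unfolding quadratic_irrational_def by blast
  show "\<theta> \<in> \<rat> \<and> \<not> unit_dyadic \<theta> \<longleftrightarrow>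
      eventually_periodic (binary_digit \<theta>) \<and> \<not> finite_expansion (binary_digit \<theta>)"
    using rational_iff_eventually_periodic unit_dyadic_iff_finite_expansion[OF assms(1)] by blast
qed

end
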